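(* Let $\Lambda$ be an arbitrary finite dimensional algebra with $n$ isomorphism classes of simple modules. Let $0\ne v\in\mathbb R^n$ and let $X\in\mathrm{mod}\,\Lambda$ be a nonzero module with $v\in D(X)$. Then $D_{0,v}(X)=D_{v^\perp}(X)$.
   Context: Algebras are basic and connected over an algebraically closed field $K$; $\mathrm{mod}\,\Lambda$ is the category of finitely generated left modules; $P(1),\dots,P(n)$ are the indecomposable projectives; $\underline{\dim}\,M=(\dim_K\mathrm{Hom}_\Lambda(P(i),M))_i\in\mathbb N^n$; $\cdot$ is the standard dot product; $v^\perp=\{w\in\mathbb R^n:v\cdot w=0\}$. For nonzero $X$, $D(X)=\{v\in\mathbb R^n\mid v\cdot\underline{\dim}\,X=0,\ v\cdot\underline{\dim}\,X'\le0\text{ for all submodules }X'\subseteq X\}$. For $v\in D(X)$, $$D_{0,v}(X)=\{w\in v^\perp\mid\exists\,\varepsilon>0:\ v+\varepsilon w\in D(X)\},$$ $$D_{v^\perp}(X)=\{w\in v^\perp\mid w\cdot\underline{\dim}\,X=0,\text{ and for all submodules }X'\subseteq X:\ v\cdot\underline{\dim}\,X'=0\Rightarrow w\cdot\underline{\dim}\,X'\le0\}.$$ *)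

theory Defs
  imports
    "HOL-Analysis.Finite_Cartesian_Product"
    "HOL-Algebra.Algebraic_Closure"
    "Jordan_Normal_Form.Missing_VectorSpace"
begin

text \<open>
  Several theory names overlap: \<open>Module.submodule\<close> is the locale of \<open>HOL-Algebra\<close> (which does not
  need a commutative ring), not the one of the \<open>VectorSpace\<close> library.

  An algebra over \<open>K\<close> is a record \<open>A :: ('k, 'a) module\<close>, which carries both a ring structure
  and a scalar multiplication by \<open>K\<close>.  Being nonzero is not required: the zero algebra has
  only zero modules.
\<close>

definition fin_dim_algebra :: "'k ring \<Rightarrow> ('k, 'a) module \<Rightarrow> bool" where
  "fin_dim_algebra K A \<longleftrightarrow>
     algebraically_closed K \<and> ring A \<and> vectorspace K A \<and> vectorspace.fin_dim K A \<and>
     (\<forall>c \<in> carrier K. \<forall>a \<in> carrier A. \<forall>b \<in> carrier A.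
        (c \<odot>\<^bsub>A\<^esub> a) \<otimes>\<^bsub>A\<^esub> b = c \<odot>\<^bsub>A\<^esub> (a \<otimes>\<^bsub>A\<^esub> b) \<and>
        a \<otimes>\<^bsub>A\<^esub> (c \<odot>\<^bsub>A\<^esub> b) = c \<odot>\<^bsub>A\<^esub> (a \<otimes>\<^bsub>A\<^esub> b))"

text \<open>
  The locale \<open>module\<close> of \<open>HOL-Algebra\<close> assumes a commutative ring; these are its axioms
  for an arbitrary ring.  The fields \<open>mult\<close> and \<open>one\<close> of the record \<open>M\<close> are irrelevant.
\<close>

locale left_module = R?: ring R + M?: abelian_group M
  for R :: "('a, 'r) ring_scheme" (structure) and M :: "('a, 'm) module" (structure) +
  assumes smult_closed:
      "a \<in> carrier R \<Longrightarrow> x \<in> carrier M \<Longrightarrow> a \<odot>\<^bsub>M\<^esub> x \<in> carrier M"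
    and smult_l_distr:
      "a \<in> carrier R \<Longrightarrow> b \<in> carrier R \<Longrightarrow> x \<in> carrier M \<Longrightarrow>
       (a \<oplus>\<^bsub>R\<^esub> b) \<odot>\<^bsub>M\<^esub> x = (a \<odot>\<^bsub>M\<^esub> x) \<oplus>\<^bsub>M\<^esub> (b \<odot>\<^bsub>M\<^esub> x)"
    and smult_r_distr:
      "a \<in> carrier R \<Longrightarrow> x \<in> carrier M \<Longrightarrow> y \<in> carrier M \<Longrightarrow>
       a \<odot>\<^bsub>M\<^esub> (x \<oplus>\<^bsub>M\<^esub> y) = (a \<odot>\<^bsub>M\<^esub> x) \<oplus>\<^bsub>M\<^esub> (a \<odot>\<^bsub>M\<^esub> y)"
    and smult_assoc:
      "a \<in> carrier R \<Longrightarrow> b \<in> carrier R \<Longrightarrow> x \<in> carrier M \<Longrightarrow>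
       (a \<otimes>\<^bsub>R\<^esub> b) \<odot>\<^bsub>M\<^esub> x = a \<odot>\<^bsub>M\<^esub> (b \<odot>\<^bsub>M\<^esub> x)"
    and smult_one: "x \<in> carrier M \<Longrightarrow> \<one>\<^bsub>R\<^esub> \<odot>\<^bsub>M\<^esub> x = x"

definition fg_left_module :: "('k, 'a) module \<Rightarrow> ('a, 'm) module \<Rightarrow> bool" where
  "fg_left_module A M \<longleftrightarrow>
     left_module A M \<and>
     (\<exists>B. finite B \<and> B \<subseteq> carrier M \<and>
        (\<forall>x \<in> carrier M. \<exists>c \<in> B \<rightarrow> carrier A. x = (\<Oplus>\<^bsub>M\<^esub>b\<in>B. c b \<odot>\<^bsub>M\<^esub> b)))"

definition nonzero_module :: "('a, 'm) module \<Rightarrow> bool" where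
  "nonzero_module M \<longleftrightarrow> carrier M \<noteq> {\<zero>\<^bsub>M\<^esub>}"

definition left_hom ::
    "('k, 'a) module \<Rightarrow> ('a, 'm) module \<Rightarrow> ('a, 'n) module \<Rightarrow> ('m \<Rightarrow> 'n) set" where
  "left_hom A M N =
     {f \<in> carrier M \<rightarrow>\<^sub>E carrier N.
        (\<forall>x \<in> carrier M. \<forall>y \<in> carrier M. f (x \<oplus>\<^bsub>M\<^esub> y) = f x \<oplus>\<^bsub>N\<^esub> f y) \<and>
        (\<forall>a \<in> carrier A. \<forall>x \<in> carrier M. f (a \<odot>\<^bsub>M\<^esub> x) = a \<odot>\<^bsub>N\<^esub> f x)}"

text \<open>
  \<open>Hom(M, N)\<close> as a \<open>K\<close>-vector space; a scalar \<open>c\<close> acts on \<open>N\<close> through the element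
  \<open>c \<cdot> 1\<close> of \<open>A\<close>.
\<close>

definition hom_space ::
    "('k, 'a) module \<Rightarrow> ('a, 'm) module \<Rightarrow> ('a, 'n) module \<Rightarrow> ('k, 'm \<Rightarrow> 'n) module" where
  "hom_space A M N =
     \<lparr>carrier = left_hom A M N, monoid.mult = undefined, one = undefined,
      zero = (\<lambda>x \<in> carrier M. \<zero>\<^bsub>N\<^esub>),
      add = (\<lambda>f g. \<lambda>x \<in> carrier M. f x \<oplus>\<^bsub>N\<^esub> g x),
      smult = (\<lambda>c f. \<lambda>x \<in> carrier M. (c \<odot>\<^bsub>A\<^esub> \<one>\<^bsub>A\<^esub>) \<odot>\<^bsub>N\<^esub> f x)\<rparr>"

definition iso_modules :: "('k, 'a) module \<Rightarrow> ('a, 'm) module \<Rightarrow> ('a, 'n) module \<Rightarrow> bool" where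
  "iso_modules A M N \<longleftrightarrow> (\<exists>f \<in> left_hom A M N. bij_betw f (carrier M) (carrier N))"

definition simple_module :: "('k, 'a) module \<Rightarrow> ('a, 'm) module \<Rightarrow> bool" where
  "simple_module A M \<longleftrightarrow>
     left_module A M \<and> nonzero_module M \<and>
     (\<forall>N. Module.submodule N A M \<longrightarrow> N = {\<zero>\<^bsub>M\<^esub>} \<or> N = carrier M)"

definition indecomposable_module :: "('k, 'a) module \<Rightarrow> ('a, 'm) module \<Rightarrow> bool" where
  "indecomposable_module A M \<longleftrightarrow>
     left_module A M \<and> nonzero_module M \<and>
     (\<forall>N1 N2. Module.submodule N1 A M \<and> Module.submodule N2 A M \<and>
        N1 \<inter> N2 = {\<zero>\<^bsub>M\<^esub>} \<and> N1 <+>\<^bsub>M\<^esub> N2 = carrier M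
        \<longrightarrow> N1 = {\<zero>\<^bsub>M\<^esub>} \<or> N2 = {\<zero>\<^bsub>M\<^esub>})"

text \<open>
  HOL cannot quantify over types, so \<open>mod A\<close> is represented by the modules with carrier in
  \<open>nat \<Rightarrow> 'k\<close>.  This loses nothing up to isomorphism: a finitely generated \<open>A\<close>-module
  has some finite dimension \<open>d\<close> over \<open>K\<close>, and its structure can be transported to
  \<open>{..<d} \<rightarrow>\<^sub>E carrier K\<close>.  The type is used wherever "all modules" or "some module" is meant.
\<close>

type_synonym ('k, 'a) coord_module = "('a, nat \<Rightarrow> 'k) module"

definition projective_module :: "('k, 'a) module \<Rightarrow> ('a, 'm) module \<Rightarrow> bool" where
  "projective_module A P \<longleftrightarrow>
     left_module A P \<and>
     (\<forall>(M :: ('k, 'a) coord_module) (N :: ('k, 'a) coord_module).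
        \<forall>g \<in> left_hom A M N. \<forall>f \<in> left_hom A P N.
          fg_left_module A M \<and> fg_left_module A N \<and> g ` carrier M = carrier N
          \<longrightarrow> (\<exists>h \<in> left_hom A P M. \<forall>x \<in> carrier P. g (h x) = f x))"

definition indec_projective :: "('k, 'a) module \<Rightarrow> ('a, 'm) module \<Rightarrow> bool" where
  "indec_projective A P \<longleftrightarrow>
     fg_left_module A P \<and> projective_module A P \<and> indecomposable_module A P"

definition simple_classes :: "('k, 'a) module \<Rightarrow> ('k, 'a) coord_module set set" where
  "simple_classes A =
     {S. simple_module A S} //
     {(S, T). simple_module A S \<and> simple_module A T \<and> iso_modules A S T}"

definition indec_projectives ::
    "('k, 'a) module \<Rightarrow> ('i \<Rightarrow> ('a, 'p) module) \<Rightarrow> bool" where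
  "indec_projectives A P \<longleftrightarrow>
     (\<forall>i. indec_projective A (P i)) \<and>
     (\<forall>i j. iso_modules A (P i) (P j) \<longrightarrow> i = j) \<and>
     (\<forall>Q :: ('k, 'a) coord_module. indec_projective A Q \<longrightarrow> (\<exists>i. iso_modules A Q (P i)))"

definition dim_vec ::
    "'k ring \<Rightarrow> ('k, 'a) module \<Rightarrow> ('i::finite \<Rightarrow> ('a, 'p) module) \<Rightarrow> ('a, 'm) module \<Rightarrow> real ^ 'i"
  where "dim_vec K A P M = (\<chi> i. real (vectorspace.dim K (hom_space A (P i) M)))"

abbreviation restrict_to :: "('a, 'm) module \<Rightarrow> 'm set \<Rightarrow> ('a, 'm) module" where
  "restrict_to M N \<equiv> M\<lparr>carrier := N\<rparr>"

definition orth :: "real ^ 'i \<Rightarrow> (real ^ 'i::finite) set" where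
  "orth v = {w. inner v w = 0}"

definition stab_domain ::
    "'k ring \<Rightarrow> ('k, 'a) module \<Rightarrow> ('i::finite \<Rightarrow> ('a, 'p) module) \<Rightarrow> ('a, 'm) module \<Rightarrow>
     (real ^ 'i) set" where
  "stab_domain K A P M =
     {v. inner v (dim_vec K A P M) = 0 \<and>
         (\<forall>N. Module.submodule N A M \<longrightarrow> inner v (dim_vec K A P (restrict_to M N)) \<le> 0)}"

text \<open>\<open>D\<^bsub>0,v\<^esub>(M)\<close>, the germ of \<open>D(M)\<close> at \<open>v\<close> in directions orthogonal to \<open>v\<close>.\<close>

definition stab_domain_local ::
    "'k ring \<Rightarrow> ('k, 'a) module \<Rightarrow> ('i::finite \<Rightarrow> ('a, 'p) module) \<Rightarrow> real ^ 'i \<Rightarrow>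
     ('a, 'm) module \<Rightarrow> (real ^ 'i) set" where
  "stab_domain_local K A P v M =
     {w \<in> orth v. \<exists>\<epsilon>>0. v + \<epsilon> *\<^sub>R w \<in> stab_domain K A P M}"

text \<open>\<open>D\<^bsub>v\<^sup>\<bottom>\<^esub>(M)\<close>, where only the submodules on which \<open>v\<close> vanishes are tested.\<close>

definition stab_domain_perp ::
    "'k ring \<Rightarrow> ('k, 'a) module \<Rightarrow> ('i::finite \<Rightarrow> ('a, 'p) module) \<Rightarrow> real ^ 'i \<Rightarrow>
     ('a, 'm) module \<Rightarrow> (real ^ 'i) set" where
  "stab_domain_perp K A P v M =
     {w \<in> orth v. inner w (dim_vec K A P M) = 0 \<and>
        (\<forall>N. Module.submodule N A M \<longrightarrow>
           inner v (dim_vec K A P (restrict_to M N)) = 0 \<longrightarrow>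
           inner w (dim_vec K A P (restrict_to M N)) \<le> 0)}"

end

theory Submission
  imports Defs
begin

text \<open>
  Moving from \<open>v\<close> to \<open>v + \<epsilon>w\<close> changes the value on a dimension vector \<open>d\<close> from \<open>v \<cdot> d\<close> to
  \<open>v \<cdot> d + \<epsilon> (w \<cdot> d)\<close>.  On the submodules with \<open>v \<cdot> d = 0\<close> the sign is that of \<open>w \<cdot> d\<close>, which
  gives the inclusion of the local domain in the one tested on \<open>v\<^sup>\<bottom>\<close>.  Conversely, the submodules
  with \<open>v \<cdot> d < 0\<close> impose nothing on \<open>w\<close> as long as \<open>\<epsilon>\<close> is small, but one \<open>\<epsilon>\<close> has to serve all
  of them, and a module can have infinitely many submodules.  The theorem therefore rests on the
  fact that only finitely many dimension vectors of submodules occur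
  (\<open>finite_submodule_dim_vecs\<close>); the perturbation argument is then
  \<open>finite_small_perturbation_nonpos\<close>.

  For the finiteness, \<open>Hom(P\<^sub>i, N)\<close> is a subspace of \<open>Hom(P\<^sub>i, M)\<close> for every submodule \<open>N\<close> of \<open>M\<close>,
  so that each entry of the dimension vector of \<open>N\<close> is at most the corresponding entry for \<open>M\<close>.
  This bound needs \<open>Hom(P\<^sub>i, M)\<close> to be finite dimensional (\<open>fin_dim_hom_space\<close>): a homomorphism
  is determined by its values on a finite set of generators of \<open>P\<^sub>i\<close>, and \<open>M\<close> is spanned over
  \<open>K\<close> by the finitely many products of a spanning set of the algebra with generators of \<open>M\<close>.
\<close>

section \<open>Finite dimensionality of vector spaces\<close>

lemma (in abelian_monoid) finsum_in_closed_subset: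
  assumes "Z \<subseteq> carrier G" "\<zero> \<in> Z" "\<And>x y. x \<in> Z \<Longrightarrow> y \<in> Z \<Longrightarrow> x \<oplus> y \<in> Z"
    and "f \<in> B \<rightarrow> Z"
  shows "(\<Oplus>b\<in>B. f b) \<in> Z"
  using assms(4)
proof (induction B rule: infinite_finite_induct)
  case (insert b B)
  then have "f \<in> B \<rightarrow> carrier G" "f b \<in> carrier G" using assms(1) by auto
  with insert show ?case using assms(3) by (simp add: Pi_iff)
qed (use assms(2) in auto)

lemma (in vectorspace) subspaceI:
  assumes "W \<subseteq> carrier V" "\<zero>\<^bsub>V\<^esub> \<in> W" "\<And>x y. x \<in> W \<Longrightarrow> y \<in> W \<Longrightarrow> x \<oplus>\<^bsub>V\<^esub> y \<in> W"
    "\<And>c x. c \<in> carrier K \<Longrightarrow> x \<in> W \<Longrightarrow> c \<odot>\<^bsub>V\<^esub> x \<in> W"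
  shows "subspace K W V"
  unfolding subspace_def LinearCombinations.submodule_def
  using assms vectorspace_axioms module_axioms by auto

lemma (in vectorspace) subspaceD:
  assumes "subspace K W V"
  shows "W \<subseteq> carrier V" "\<zero>\<^bsub>V\<^esub> \<in> W" "\<And>x y. x \<in> W \<Longrightarrow> y \<in> W \<Longrightarrow> x \<oplus>\<^bsub>V\<^esub> y \<in> W"
    "\<And>c x. c \<in> carrier K \<Longrightarrow> x \<in> W \<Longrightarrow> c \<odot>\<^bsub>V\<^esub> x \<in> W"
  using assms unfolding subspace_def LinearCombinations.submodule_def by auto

text \<open>
  Linear independence in the subspace and in the whole space agree, so the independent sets of
  the subspace have at most \<open>dim\<close> elements; a maximal one is a finite basis.
\<close>

lemma (in vectorspace) subspace_fin_dim_and_dim_le: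
  assumes fd: "fin_dim" and W: "subspace K W V"
  shows "vectorspace.fin_dim K (vs W)" and "vectorspace.dim K (vs W) \<le> dim"
proof -
  interpret W: vectorspace K "vs W" by (rule subspace_is_vs[OF W])
  have li: "finite S \<and> card S \<le> dim" if "S \<subseteq> W \<and> W.lin_indpt S" for S
    using that span_li_not_depend(2)[OF _ is_module[OF W]] li_le_dim[OF fd, of S] subspaceD(1)[OF W]
    by auto
  have "W.lin_indpt {}" unfolding W.lin_dep_def by auto
  then obtain S where S: "maximal S (\<lambda>S. S \<subseteq> W \<and> W.lin_indpt S)"
    using maximal_exists[of "\<lambda>S. S \<subseteq> W \<and> W.lin_indpt S" dim "{}"] li by auto
  then have "finite S" "card S \<le> dim" using li unfolding maximal_def by blast+
  moreover have "W.basis S" using W.max_li_is_basis S by auto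
  ultimately show "W.fin_dim" "W.dim \<le> dim"
    using W.dim_basis unfolding W.fin_dim_def W.basis_def by auto
qed

text \<open>
  The finiteness behind rank-nullity: a spanning set of the kernel together with preimages of a spanning set of the image spans the
  domain.
\<close>

lemma (in linear_map) fin_dim_if_kernel_and_codomain_fin_dim:
  assumes "W.fin_dim" and "vectorspace.fin_dim K (V.vs kerT)"
  shows "V.fin_dim"
proof -
  interpret ker: vectorspace K "V.vs kerT" by (rule V.subspace_is_vs[OF kerT_is_subspace])
  interpret im: vectorspace K "W.vs imT" by (rule W.subspace_is_vs[OF imT_is_subspace])
  obtain D where D: "finite D" "D \<subseteq> kerT" "ker.span D = kerT"
    using assms(2) unfolding ker.fin_dim_def by auto
  obtain E where E: "finite E" "E \<subseteq> imT" "im.span E = imT"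
    using W.subspace_fin_dim_and_dim_le(1)[OF assms(1) imT_is_subspace]
    unfolding im.fin_dim_def by auto
  obtain C where C: "finite C" "C \<subseteq> carrier V" "E = T ` C"
    using finite_subset_image[of E T "carrier V"] E unfolding im_def by auto
  \<comment> \<open>\<open>C\<close> lifts a spanning set of the image, and \<open>D\<close> spans the kernel.\<close>
  define S where "S = V.module.span (C \<union> D)"
  have CD: "C \<union> D \<subseteq> carrier V" using C D unfolding ker_def by auto
  have S: "subspace K S V" unfolding S_def by (rule V.span_is_subspace[OF CD])
  note S' = V.subspaceD[OF S]
  have CDS: "C \<union> D \<subseteq> S" unfolding S_def by (rule V.module.in_own_span[OF CD])
  have TS: "subspace K (T ` S) W"
  proof (rule W.subspaceI)
    show "T ` S \<subseteq> carrier W" using S'(1) by auto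
    show "\<zero>\<^bsub>W\<^esub> \<in> T ` S" using S'(2) T0_is_0 by (metis imageI)
    show "x \<oplus>\<^bsub>W\<^esub> y \<in> T ` S" if xy: "x \<in> T ` S" "y \<in> T ` S" for x y
    proof -
      obtain a b where "a \<in> S" "b \<in> S" "x = T a" "y = T b" using xy by auto
      moreover have "T (a \<oplus>\<^bsub>V\<^esub> b) = T a \<oplus>\<^bsub>W\<^esub> T b" using calculation S'(1) T_add[of a b] by blast
      ultimately show ?thesis using S'(3) by (metis imageI)
    qed
    show "c \<odot>\<^bsub>W\<^esub> x \<in> T ` S" if c: "c \<in> carrier K" and x: "x \<in> T ` S" for c x
    proof -
      obtain a where "a \<in> S" "x = T a" using x by auto
      moreover have "T (c \<odot>\<^bsub>V\<^esub> a) = c \<odot>\<^bsub>W\<^esub> T a" using calculation S'(1) c T_smult[of c a] by blast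
      ultimately show ?thesis using S'(4) c by (metis imageI)
    qed
  qed
  have "W.module.span E \<subseteq> T ` S"
    by (rule W.module.span_is_subset[OF _ W.is_module[OF TS]]) (use C CDS in auto)
  moreover have "W.module.span E = imT"
    using W.module.span_li_not_depend(1)[OF E(2) W.is_module[OF imT_is_subspace]] E(3) by simp
  ultimately have imS: "imT \<subseteq> T ` S" by simp
  have "V.module.span D \<subseteq> S"
    by (rule V.module.span_is_subset[OF _ V.is_module[OF S]]) (use CDS in auto)
  moreover have "V.module.span D = kerT"
    using V.module.span_li_not_depend(1)[OF D(2) V.is_module[OF kerT_is_subspace]] D(3) by simp
  ultimately have kerS: "kerT \<subseteq> S" by simp
  have "carrier V \<subseteq> S"
  proof
    fix x assume x: "x \<in> carrier V"
    then obtain s where s: "s \<in> S" "T x = T s" using imS unfolding im_def by auto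
    then have sV: "s \<in> carrier V" using S'(1) by auto
    have "T (x \<ominus>\<^bsub>V\<^esub> s) = \<zero>\<^bsub>W\<^esub>" using x sV s(2) by simp
    then have "x \<ominus>\<^bsub>V\<^esub> s \<in> S" using kerS x sV unfolding ker_def by auto
    then have "(x \<ominus>\<^bsub>V\<^esub> s) \<oplus>\<^bsub>V\<^esub> s \<in> S" using s(1) S'(3) by auto
    moreover have "(x \<ominus>\<^bsub>V\<^esub> s) \<oplus>\<^bsub>V\<^esub> s = x"
      using x sV by (simp add: a_minus_def V.module.M.a_assoc V.module.M.l_neg)
    ultimately show "x \<in> S" by simp
  qed
  then have "V.module.span (C \<union> D) = carrier V" using S'(1) unfolding S_def by blast
  then show ?thesis unfolding V.fin_dim_def using C(1) D(1) CD by blast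
qed

text \<open>
  A space that finitely many linear maps embed into a power \<open>W\<^sup>B\<close> is finite dimensional.  Instead
  of constructing that power, the maps are added one at a time: each step passes from the common
  kernel of fewer maps to the kernel of one more map restricted to it.
\<close>

lemma fin_dim_if_jointly_injective:
  assumes V: "vectorspace K V" and W: "vectorspace K W" "vectorspace.fin_dim K W"
    and B: "finite B" and T: "\<And>b. b \<in> B \<Longrightarrow> linear_map K V W (T b)"
    and inj: "\<And>x. x \<in> carrier V \<Longrightarrow> \<forall>b\<in>B. T b x = \<zero>\<^bsub>W\<^esub> \<Longrightarrow> x = \<zero>\<^bsub>V\<^esub>"
  shows "vectorspace.fin_dim K V"
proof -
  interpret V: vectorspace K V by (rule V)
  interpret W: vectorspace K W by (rule W)
  let ?U = "\<lambda>C. {x \<in> carrier V. \<forall>b\<in>C. T b x = \<zero>\<^bsub>W\<^esub>}"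
  have U: "subspace K (?U C) V" if C: "C \<subseteq> B" for C
  proof -
    have lin: "linear_map K V W (T b)" if "b \<in> C" for b using T C that by blast
    have "T b \<zero>\<^bsub>V\<^esub> = \<zero>\<^bsub>W\<^esub>" "\<And>x y. x \<in> carrier V \<Longrightarrow> y \<in> carrier V \<Longrightarrow> T b (x \<oplus>\<^bsub>V\<^esub> y) = T b x \<oplus>\<^bsub>W\<^esub> T b y"
      "\<And>c x. c \<in> carrier K \<Longrightarrow> x \<in> carrier V \<Longrightarrow> T b (c \<odot>\<^bsub>V\<^esub> x) = c \<odot>\<^bsub>W\<^esub> T b x" if "b \<in> C" for b
      using linear_map.T0_is_0[OF lin] linear_map.T_add[OF lin] linear_map.T_smult[OF lin] that
      by blast+
    then show ?thesis by (intro V.subspaceI) auto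
  qed
  \<comment> \<open>The common kernel for \<open>C = {}\<close> is \<open>V\<close> itself, and for \<open>C = B\<close> it is zero.\<close>
  have "vectorspace.fin_dim K (V.vs (?U C)) \<Longrightarrow> V.fin_dim" if "C \<subseteq> B" for C
    using finite_subset[OF that B] that
  proof (induction C)
    case empty
    then show ?case by simp
  next
    case (insert b C)
    interpret U: vectorspace K "V.vs (?U C)" by (rule V.subspace_is_vs, rule U) (use insert in auto)
    interpret Tb: linear_map K V W "T b" using T insert by auto
    interpret R: linear_map K "V.vs (?U C)" W "T b"
      by unfold_locales (auto simp: module_hom_def)
    have "R.ker = ?U (insert b C)" unfolding R.ker_def by auto
    then have "U.fin_dim"
      using R.fin_dim_if_kernel_and_codomain_fin_dim[OF W(2)] insert.prems by simp
    then show ?case using insert by auto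
  qed
  moreover have "vectorspace.fin_dim K (V.vs (?U B))"
  proof -
    have eq: "?U B = {\<zero>\<^bsub>V\<^esub>}" using inj V.subspaceD(2)[OF U[of B]] by auto
    interpret Z: vectorspace K "V.vs {\<zero>\<^bsub>V\<^esub>}" using V.subspace_is_vs[OF U[of B]] eq by simp
    show ?thesis unfolding eq Z.fin_dim_def using Z.span_empty by (intro exI[of _ "{}"]) auto
  qed
  ultimately show ?thesis by blast
qed

section \<open>Homomorphism spaces over a finite dimensional algebra\<close>

text \<open>
  A module over the algebra as a vector space over \<open>K\<close>.  Scalars act through \<open>c \<cdot> 1\<close>, as they do
  on \<open>hom_space\<close>, so that evaluation of homomorphisms at a point is \<open>K\<close>-linear.
\<close>

definition scalar_restriction :: "('k, 'a) module \<Rightarrow> ('a, 'm) module \<Rightarrow> ('k, 'm) module" where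
  "scalar_restriction A M =
     \<lparr>carrier = carrier M, monoid.mult = monoid.mult M, one = \<one>\<^bsub>M\<^esub>, zero = \<zero>\<^bsub>M\<^esub>,
      add = (\<oplus>\<^bsub>M\<^esub>),
      smult = (\<lambda>c x. (c \<odot>\<^bsub>A\<^esub> \<one>\<^bsub>A\<^esub>) \<odot>\<^bsub>M\<^esub> x)\<rparr>"

lemma scalar_restriction_simps [simp]:
  "carrier (scalar_restriction A M) = carrier M"
  "\<zero>\<^bsub>scalar_restriction A M\<^esub> = \<zero>\<^bsub>M\<^esub>"
  "x \<oplus>\<^bsub>scalar_restriction A M\<^esub> y = x \<oplus>\<^bsub>M\<^esub> y"
  "c \<odot>\<^bsub>scalar_restriction A M\<^esub> x = (c \<odot>\<^bsub>A\<^esub> \<one>\<^bsub>A\<^esub>) \<odot>\<^bsub>M\<^esub> x"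
  by (simp_all add: scalar_restriction_def)

lemma hom_space_simps [simp]:
  "carrier (hom_space A P M) = left_hom A P M"
  "\<zero>\<^bsub>hom_space A P M\<^esub> = (\<lambda>x \<in> carrier P. \<zero>\<^bsub>M\<^esub>)"
  "f \<oplus>\<^bsub>hom_space A P M\<^esub> g = (\<lambda>x \<in> carrier P. f x \<oplus>\<^bsub>M\<^esub> g x)"
  "c \<odot>\<^bsub>hom_space A P M\<^esub> f = (\<lambda>x \<in> carrier P. (c \<odot>\<^bsub>A\<^esub> \<one>\<^bsub>A\<^esub>) \<odot>\<^bsub>M\<^esub> f x)"
  by (simp_all add: hom_space_def)

lemma left_homD:
  assumes "f \<in> left_hom A P M"
  shows "f \<in> extensional (carrier P)"
    and "x \<in> carrier P \<Longrightarrow> f x \<in> carrier M"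
    and "x \<in> carrier P \<Longrightarrow> y \<in> carrier P \<Longrightarrow> f (x \<oplus>\<^bsub>P\<^esub> y) = f x \<oplus>\<^bsub>M\<^esub> f y"
    and "a \<in> carrier A \<Longrightarrow> x \<in> carrier P \<Longrightarrow> f (a \<odot>\<^bsub>P\<^esub> x) = a \<odot>\<^bsub>M\<^esub> f x"
  using assms unfolding left_hom_def by (auto simp: PiE_def)

lemma (in left_module) zero_smult: "x \<in> carrier M \<Longrightarrow> \<zero> \<odot>\<^bsub>M\<^esub> x = \<zero>\<^bsub>M\<^esub>"
  using smult_l_distr[of "\<zero>" "\<zero>" x] smult_closed[of "\<zero>" x] M.add.l_cancel_one by force

lemma (in left_module) smult_zero: "a \<in> carrier R \<Longrightarrow> a \<odot>\<^bsub>M\<^esub> \<zero>\<^bsub>M\<^esub> = \<zero>\<^bsub>M\<^esub>"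
  using smult_r_distr[of a "\<zero>\<^bsub>M\<^esub>" "\<zero>\<^bsub>M\<^esub>"] smult_closed[of a "\<zero>\<^bsub>M\<^esub>"] M.add.l_cancel_one by force

locale finite_dimensional_algebra =
  fixes K :: "'k ring" and A :: "('k, 'a) module"
  assumes fin_dim_algebra: "fin_dim_algebra K A"
begin

sublocale alg: vectorspace K A
  using fin_dim_algebra unfolding fin_dim_algebra_def by auto

sublocale alg_ring: ring A
  using fin_dim_algebra unfolding fin_dim_algebra_def by auto

abbreviation unit_scalar :: "'k \<Rightarrow> 'a" where
  "unit_scalar c \<equiv> c \<odot>\<^bsub>A\<^esub> \<one>\<^bsub>A\<^esub>"

text \<open>
  The elements \<open>c \<cdot> 1\<close> are central.  This makes \<open>c \<cdot> f\<close> linear over the algebra whenever \<open>f\<close> is.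
\<close>

lemma unit_scalar_mult:
  assumes "c \<in> carrier K" "a \<in> carrier A"
  shows "unit_scalar c \<otimes>\<^bsub>A\<^esub> a = c \<odot>\<^bsub>A\<^esub> a" and "a \<otimes>\<^bsub>A\<^esub> unit_scalar c = c \<odot>\<^bsub>A\<^esub> a"
  using fin_dim_algebra assms unfolding fin_dim_algebra_def by auto

lemma unit_scalar_mult_distrib:
  assumes "c \<in> carrier K" "d \<in> carrier K"
  shows "unit_scalar (c \<otimes>\<^bsub>K\<^esub> d) = unit_scalar c \<otimes>\<^bsub>A\<^esub> unit_scalar d"
  using assms unit_scalar_mult(1)[of c "unit_scalar d"] by (simp add: alg.smult_assoc1)

lemma vectorspace_scalar_restriction:
  fixes M :: "('a, 'm) module"
  assumes "left_module A M"
  shows "vectorspace K (scalar_restriction A M)"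
proof -
  interpret M: left_module A M by (rule assms)
  show ?thesis
  proof (rule vs_criteria)
    show "field K" by (rule alg.field_axioms)
    show "\<forall>v\<in>carrier (scalar_restriction A M). \<exists>w\<in>carrier (scalar_restriction A M).
        v \<oplus>\<^bsub>scalar_restriction A M\<^esub> w = \<zero>\<^bsub>scalar_restriction A M\<^esub>"
      using M.M.add.inv_closed M.M.r_neg by auto
    show "\<forall>a b v. a \<in> carrier K \<and> b \<in> carrier K \<and> v \<in> carrier (scalar_restriction A M) \<longrightarrow>
        (a \<otimes>\<^bsub>K\<^esub> b) \<odot>\<^bsub>scalar_restriction A M\<^esub> v =
        a \<odot>\<^bsub>scalar_restriction A M\<^esub> (b \<odot>\<^bsub>scalar_restriction A M\<^esub> v)"
      by (auto simp: unit_scalar_mult_distrib M.smult_assoc)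
    show "\<forall>a b v. a \<in> carrier K \<and> b \<in> carrier K \<and> v \<in> carrier (scalar_restriction A M) \<longrightarrow>
        (a \<oplus>\<^bsub>K\<^esub> b) \<odot>\<^bsub>scalar_restriction A M\<^esub> v =
        a \<odot>\<^bsub>scalar_restriction A M\<^esub> v \<oplus>\<^bsub>scalar_restriction A M\<^esub> b \<odot>\<^bsub>scalar_restriction A M\<^esub> v"
      by (auto simp: alg.smult_l_distr M.smult_l_distr)
  qed (auto simp: M.M.a_ac M.smult_closed M.smult_r_distr M.smult_one)
qed

text \<open>
  If \<open>G\<close> spans the algebra and \<open>B\<close> generates the module, then the products \<open>g b\<close> span it over \<open>K\<close>:
  for fixed \<open>b \<in> B\<close>, the \<open>a\<close> with \<open>a b\<close> in their span form a subspace that contains \<open>G\<close>.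
\<close>

lemma fin_dim_scalar_restriction:
  fixes M :: "('a, 'm) module"
  assumes "fg_left_module A M"
  shows "vectorspace.fin_dim K (scalar_restriction A M)"
proof -
  let ?V = "scalar_restriction A M"
  interpret M: left_module A M using assms unfolding fg_left_module_def by auto
  interpret V: vectorspace K ?V by (rule vectorspace_scalar_restriction) (rule M.left_module_axioms)
  obtain B where B: "finite B" "B \<subseteq> carrier M"
    "\<And>x. x \<in> carrier M \<Longrightarrow> \<exists>c \<in> B \<rightarrow> carrier A. x = (\<Oplus>\<^bsub>M\<^esub>b\<in>B. c b \<odot>\<^bsub>M\<^esub> b)"
    using assms unfolding fg_left_module_def by blast
  obtain G where G: "finite G" "G \<subseteq> carrier A" "alg.span G = carrier A"
    using fin_dim_algebra unfolding fin_dim_algebra_def alg.fin_dim_def by auto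
  define S where "S = (\<lambda>(g, b). g \<odot>\<^bsub>M\<^esub> b) ` (G \<times> B)"
  have S: "S \<subseteq> carrier ?V" unfolding S_def using G(2) B(2) M.smult_closed by auto
  note span = V.subspaceD[OF V.span_is_subspace[OF S]]
  have smult_in_span: "a \<odot>\<^bsub>M\<^esub> b \<in> V.span S" if a: "a \<in> carrier A" and b: "b \<in> B" for a b
  proof -
    let ?Z = "{a \<in> carrier A. a \<odot>\<^bsub>M\<^esub> b \<in> V.span S}"
    have bM: "b \<in> carrier M" using b B(2) by auto
    have "subspace K ?Z A"
    proof (rule alg.subspaceI)
      show "\<zero>\<^bsub>A\<^esub> \<in> ?Z" using span(2) M.zero_smult bM by simp
      show "x \<oplus>\<^bsub>A\<^esub> y \<in> ?Z" if "x \<in> ?Z" "y \<in> ?Z" for x y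
        using that span(3) M.smult_l_distr bM by auto
      show "c \<odot>\<^bsub>A\<^esub> x \<in> ?Z" if c: "c \<in> carrier K" and x: "x \<in> ?Z" for c x
      proof -
        have "(c \<odot>\<^bsub>A\<^esub> x) \<odot>\<^bsub>M\<^esub> b = unit_scalar c \<odot>\<^bsub>M\<^esub> (x \<odot>\<^bsub>M\<^esub> b)"
          using c x bM unit_scalar_mult(1)[of c x] M.smult_assoc[of "unit_scalar c" x b] by simp
        then show ?thesis using span(4)[OF c, of "x \<odot>\<^bsub>M\<^esub> b"] c x by simp
      qed
    qed auto
    moreover have "G \<subseteq> ?Z" using V.in_own_span[OF S] G(2) b unfolding S_def by auto
    ultimately have "alg.span G \<subseteq> ?Z" by (intro alg.span_is_subset alg.is_module)
    then show ?thesis using a G(3) by auto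
  qed
  have "x \<in> V.span S" if "x \<in> carrier M" for x
  proof -
    obtain c where c: "c \<in> B \<rightarrow> carrier A" "x = (\<Oplus>\<^bsub>M\<^esub>b\<in>B. c b \<odot>\<^bsub>M\<^esub> b)"
      using B(3) \<open>x \<in> carrier M\<close> by blast
    show ?thesis unfolding c(2)
      by (rule M.M.finsum_in_closed_subset) (use span smult_in_span c(1) in \<open>auto simp: Pi_iff\<close>)
  qed
  then have "V.span S = carrier ?V" using span(1) by auto
  moreover have "finite S" unfolding S_def using G(1) B(1) by auto
  ultimately show ?thesis unfolding V.fin_dim_def using S by blast
qed

context
  fixes P :: "('a, 'p) module" and M :: "('a, 'm) module"
  assumes P: "left_module A P" and M: "left_module A M"
begin

interpretation P: left_module A P by (rule P)
interpretation M: left_module A M by (rule M)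

lemma zero_left_hom: "(\<lambda>x \<in> carrier P. \<zero>\<^bsub>M\<^esub>) \<in> left_hom A P M"
  unfolding left_hom_def by (auto simp: P.smult_closed M.smult_zero)

lemma add_left_hom:
  assumes "f \<in> left_hom A P M" "g \<in> left_hom A P M"
  shows "(\<lambda>x \<in> carrier P. f x \<oplus>\<^bsub>M\<^esub> g x) \<in> left_hom A P M"
  using left_homD[OF assms(1)] left_homD[OF assms(2)] unfolding left_hom_def
  by (auto simp: P.smult_closed M.smult_r_distr M.M.a_ac)

lemma smult_left_hom:
  assumes "c \<in> carrier K" "f \<in> left_hom A P M"
  shows "(\<lambda>x \<in> carrier P. unit_scalar c \<odot>\<^bsub>M\<^esub> f x) \<in> left_hom A P M"
proof -
  have "unit_scalar c \<odot>\<^bsub>M\<^esub> (a \<odot>\<^bsub>M\<^esub> y) = a \<odot>\<^bsub>M\<^esub> (unit_scalar c \<odot>\<^bsub>M\<^esub> y)"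
    if "a \<in> carrier A" "y \<in> carrier M" for a y
    using that assms(1) unit_scalar_mult[of c a] M.smult_assoc[of a "unit_scalar c" y]
      M.smult_assoc[of "unit_scalar c" a y] by simp
  then show ?thesis
    using left_homD[OF assms(2)] assms(1) unfolding left_hom_def
    by (auto simp: P.smult_closed M.smult_closed M.smult_r_distr)
qed

lemma vectorspace_hom_space: "vectorspace K (hom_space A P M)"
proof (rule vs_criteria)
  let ?V = "hom_space A P M"
  note hom = left_homD(2)[where A = A and P = P and M = M]
  show "field K" by (rule alg.field_axioms)
  show "\<zero>\<^bsub>?V\<^esub> \<in> carrier ?V" using zero_left_hom by simp
  show "\<forall>v w. v \<in> carrier ?V \<and> w \<in> carrier ?V \<longrightarrow> v \<oplus>\<^bsub>?V\<^esub> w \<in> carrier ?V"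
    using add_left_hom by simp
  show "\<forall>c v. c \<in> carrier K \<and> v \<in> carrier ?V \<longrightarrow> c \<odot>\<^bsub>?V\<^esub> v \<in> carrier ?V"
    using smult_left_hom by simp
  show "\<forall>v\<in>carrier ?V. \<exists>w\<in>carrier ?V. v \<oplus>\<^bsub>?V\<^esub> w = \<zero>\<^bsub>?V\<^esub>"
  proof
    fix f assume "f \<in> carrier ?V"
    then have f: "f \<in> left_hom A P M" by simp
    let ?g = "\<lambda>x \<in> carrier P. unit_scalar (\<ominus>\<^bsub>K\<^esub> \<one>\<^bsub>K\<^esub>) \<odot>\<^bsub>M\<^esub> f x"
    \<comment> \<open>The negative is written as \<open>(-1) \<cdot> f\<close>, so that \<open>smult_left_hom\<close> applies to it.\<close>
    have "f x \<oplus>\<^bsub>M\<^esub> unit_scalar (\<ominus>\<^bsub>K\<^esub> \<one>\<^bsub>K\<^esub>) \<odot>\<^bsub>M\<^esub> f x = \<zero>\<^bsub>M\<^esub>" if "x \<in> carrier P" for x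
    proof -
      interpret V: vectorspace K "scalar_restriction A M"
        by (rule vectorspace_scalar_restriction) (rule M)
      show ?thesis
        using V.smult_minus_1[of "f x"] V.M.r_neg[of "f x"] hom[OF f that] by simp
    qed
    then have "f \<oplus>\<^bsub>?V\<^esub> ?g = \<zero>\<^bsub>?V\<^esub>" by (auto intro!: restrict_ext)
    moreover have "?g \<in> carrier ?V" using smult_left_hom[OF _ f] by simp
    ultimately show "\<exists>w\<in>carrier ?V. f \<oplus>\<^bsub>?V\<^esub> w = \<zero>\<^bsub>?V\<^esub>" by blast
  qed
  show "\<forall>v\<in>carrier ?V. v \<oplus>\<^bsub>?V\<^esub> \<zero>\<^bsub>?V\<^esub> = v"
    by (auto intro!: extensionalityI[of _ "carrier P"] simp: left_homD)
  show "\<forall>v\<in>carrier ?V. \<one>\<^bsub>K\<^esub> \<odot>\<^bsub>?V\<^esub> v = v"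
    by (auto intro!: extensionalityI[of _ "carrier P"] simp: left_homD M.smult_one)
  show "\<forall>a b v. a \<in> carrier K \<and> b \<in> carrier K \<and> v \<in> carrier ?V \<longrightarrow>
      (a \<otimes>\<^bsub>K\<^esub> b) \<odot>\<^bsub>?V\<^esub> v = a \<odot>\<^bsub>?V\<^esub> (b \<odot>\<^bsub>?V\<^esub> v)"
    using hom by (auto intro!: restrict_ext simp: unit_scalar_mult_distrib M.smult_assoc)
  show "\<forall>a b v. a \<in> carrier K \<and> b \<in> carrier K \<and> v \<in> carrier ?V \<longrightarrow>
      (a \<oplus>\<^bsub>K\<^esub> b) \<odot>\<^bsub>?V\<^esub> v = a \<odot>\<^bsub>?V\<^esub> v \<oplus>\<^bsub>?V\<^esub> b \<odot>\<^bsub>?V\<^esub> v"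
    using hom by (auto intro!: restrict_ext simp: alg.smult_l_distr M.smult_l_distr)
  show "\<forall>a v w. a \<in> carrier K \<and> v \<in> carrier ?V \<and> w \<in> carrier ?V \<longrightarrow>
      a \<odot>\<^bsub>?V\<^esub> (v \<oplus>\<^bsub>?V\<^esub> w) = a \<odot>\<^bsub>?V\<^esub> v \<oplus>\<^bsub>?V\<^esub> a \<odot>\<^bsub>?V\<^esub> w"
    using hom by (auto intro!: restrict_ext simp: M.smult_r_distr)
  show "\<forall>v w. v \<in> carrier ?V \<and> w \<in> carrier ?V \<longrightarrow> v \<oplus>\<^bsub>?V\<^esub> w = w \<oplus>\<^bsub>?V\<^esub> v"
    using hom by (auto intro!: restrict_ext simp: M.M.a_comm)
  show "\<forall>v w x. v \<in> carrier ?V \<and> w \<in> carrier ?V \<and> x \<in> carrier ?V \<longrightarrow>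
      v \<oplus>\<^bsub>?V\<^esub> w \<oplus>\<^bsub>?V\<^esub> x = v \<oplus>\<^bsub>?V\<^esub> (w \<oplus>\<^bsub>?V\<^esub> x)"
    using hom by (auto intro!: restrict_ext simp: M.M.a_assoc)
qed

text \<open>
  The evaluations at a finite set of generators of \<open>P\<close> are jointly injective, since a
  homomorphism that kills the generators kills all their combinations.
\<close>

lemma fin_dim_hom_space:
  assumes "fg_left_module A P" and "fg_left_module A M"
  shows "vectorspace.fin_dim K (hom_space A P M)"
proof -
  interpret V: vectorspace K "hom_space A P M" by (rule vectorspace_hom_space)
  interpret W: vectorspace K "scalar_restriction A M"
    by (rule vectorspace_scalar_restriction) (rule M)
  obtain B where B: "finite B" "B \<subseteq> carrier P"
    "\<And>x. x \<in> carrier P \<Longrightarrow> \<exists>c \<in> B \<rightarrow> carrier A. x = (\<Oplus>\<^bsub>P\<^esub>b\<in>B. c b \<odot>\<^bsub>P\<^esub> b)"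
    using assms(1) unfolding fg_left_module_def by blast
  show ?thesis
  proof (rule fin_dim_if_jointly_injective[OF V.vectorspace_axioms W.vectorspace_axioms
        fin_dim_scalar_restriction[OF assms(2)] B(1)])
    fix b assume "b \<in> B"
    then have b: "b \<in> carrier P" using B(2) by auto
    show "linear_map K (hom_space A P M) (scalar_restriction A M) (\<lambda>f. f b)"
      by unfold_locales (auto simp: module_hom_def b left_homD(2))
  next
    fix f assume "f \<in> carrier (hom_space A P M)"
      and f0: "\<forall>b\<in>B. f b = \<zero>\<^bsub>scalar_restriction A M\<^esub>"
    then have f: "f \<in> left_hom A P M" by simp
    let ?Z = "{x \<in> carrier P. f x = \<zero>\<^bsub>M\<^esub>}"
    have "f \<zero>\<^bsub>P\<^esub> = \<zero>\<^bsub>M\<^esub>"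
      using left_homD(4)[OF f, of "\<zero>\<^bsub>A\<^esub>" "\<zero>\<^bsub>P\<^esub>"] left_homD(2)[OF f, of "\<zero>\<^bsub>P\<^esub>"]
      by (simp add: P.zero_smult M.zero_smult)
    then have "f x = \<zero>\<^bsub>M\<^esub>" if x: "x \<in> carrier P" for x
    proof -
      obtain c where c: "c \<in> B \<rightarrow> carrier A" "x = (\<Oplus>\<^bsub>P\<^esub>b\<in>B. c b \<odot>\<^bsub>P\<^esub> b)"
        using B(3) x by blast
      have "(\<Oplus>\<^bsub>P\<^esub>b\<in>B. c b \<odot>\<^bsub>P\<^esub> b) \<in> ?Z"
      proof (rule P.M.finsum_in_closed_subset)
        show "(\<lambda>b. c b \<odot>\<^bsub>P\<^esub> b) \<in> B \<rightarrow> ?Z"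
        proof
          fix b assume b: "b \<in> B"
          then have "b \<in> carrier P" "c b \<in> carrier A" using B(2) c(1) by auto
          then show "c b \<odot>\<^bsub>P\<^esub> b \<in> ?Z"
            using f0 b left_homD(4)[OF f] by (simp add: P.smult_closed M.smult_zero)
        qed
      qed (use \<open>f \<zero>\<^bsub>P\<^esub> = \<zero>\<^bsub>M\<^esub>\<close> left_homD(3)[OF f] in auto)
      then show ?thesis using c(2) by simp
    qed
    then show "f = \<zero>\<^bsub>hom_space A P M\<^esub>"
      using left_homD(1)[OF f] by (auto intro!: extensionalityI[of _ "carrier P"])
  qed
qed

text \<open>
  Corestricting to a submodule changes only the carrier of the space of homomorphisms.  Hence
  homomorphisms into the submodule form a subspace of those into \<open>M\<close> on the nose, without an
  inclusion map.
\<close>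

lemma hom_space_restrict_to:
  "hom_space A P (restrict_to M N) = (hom_space A P M)\<lparr>carrier := left_hom A P (restrict_to M N)\<rparr>"
  by (simp add: hom_space_def)

lemma subspace_left_hom_submodule:
  assumes N: "Module.submodule N A M"
  shows "subspace K (left_hom A P (restrict_to M N)) (hom_space A P M)"
proof -
  interpret V: vectorspace K "hom_space A P M" by (rule vectorspace_hom_space)
  have sub: "subgroup N (add_monoid M)" and N_smult: "\<And>a x. a \<in> carrier A \<Longrightarrow> x \<in> N \<Longrightarrow> a \<odot>\<^bsub>M\<^esub> x \<in> N"
    using N Module.submodule.smult_closed[OF N] by (auto simp: Module.submodule_def)
  have N': "N \<subseteq> carrier M" "\<zero>\<^bsub>M\<^esub> \<in> N" "\<And>x y. x \<in> N \<Longrightarrow> y \<in> N \<Longrightarrow> x \<oplus>\<^bsub>M\<^esub> y \<in> N"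
    using subgroup.subset[OF sub] subgroup.one_closed[OF sub] subgroup.m_closed[OF sub] by auto
  have iff: "f \<in> left_hom A P (restrict_to M N) \<longleftrightarrow>
      f \<in> left_hom A P M \<and> (\<forall>x\<in>carrier P. f x \<in> N)" for f
    using N'(1) unfolding left_hom_def by auto
  show ?thesis
  proof (rule V.subspaceI)
    show "\<zero>\<^bsub>hom_space A P M\<^esub> \<in> left_hom A P (restrict_to M N)"
      using zero_left_hom N'(2) by (simp add: iff)
  qed (use add_left_hom smult_left_hom N'(3) N_smult in \<open>auto simp: iff\<close>)
qed

lemma dim_hom_space_submodule_le:
  assumes "fg_left_module A P" and "fg_left_module A M" and "Module.submodule N A M"
  shows "vectorspace.dim K (hom_space A P (restrict_to M N)) \<le> vectorspace.dim K (hom_space A P M)"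
  unfolding hom_space_restrict_to
  by (rule vectorspace.subspace_fin_dim_and_dim_le(2)[OF vectorspace_hom_space
        fin_dim_hom_space[OF assms(1,2)] subspace_left_hom_submodule[OF assms(3)]])

end

text \<open>
  The dimension vectors of submodules are vectors of natural numbers in the box below the
  dimension vector of \<open>M\<close>.
\<close>

lemma finite_submodule_dim_vecs:
  fixes P :: "'n::finite \<Rightarrow> ('a, 'p) module" and M :: "('a, 'm) module"
  assumes "\<And>i. fg_left_module A (P i)" and "fg_left_module A M"
  shows "finite {dim_vec K A P (restrict_to M N) | N. Module.submodule N A M}"
proof (rule finite_subset)
  let ?d = "\<lambda>i. vectorspace.dim K (hom_space A (P i) M)"
  let ?D = "(\<lambda>g. \<chi> i. real (g i)) ` (\<Pi>\<^sub>E i\<in>UNIV. {..?d i})"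
  show "finite ?D" by (intro finite_imageI finite_PiE) auto
  show "{dim_vec K A P (restrict_to M N) | N. Module.submodule N A M} \<subseteq> ?D"
  proof clarify
    fix N assume N: "Module.submodule N A M"
    have "(\<lambda>i. vectorspace.dim K (hom_space A (P i) (restrict_to M N))) \<in> (\<Pi>\<^sub>E i\<in>UNIV. {..?d i})"
      using dim_hom_space_submodule_le[OF _ _ assms(1) assms(2) N] assms
      unfolding fg_left_module_def by auto
    then show "dim_vec K A P (restrict_to M N) \<in> ?D" unfolding dim_vec_def by (rule rev_image_eqI) simp
  qed
qed

end

section \<open>The stability domain near a point\<close>

text \<open>
  Each \<open>d\<close> excludes no small \<open>\<epsilon> > 0\<close>: strict inequalities persist by continuity, and the other
  ones by hypothesis.  For finitely many \<open>d\<close> these conditions hold simultaneously.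
\<close>

lemma finite_small_perturbation_nonpos:
  fixes v w :: "'v::real_inner"
  assumes "finite F" and "\<And>d. d \<in> F \<Longrightarrow> inner v d \<le> 0"
    and "\<And>d. d \<in> F \<Longrightarrow> inner v d = 0 \<Longrightarrow> inner w d \<le> 0"
  shows "\<exists>\<epsilon>>0. \<forall>d\<in>F. inner (v + \<epsilon> *\<^sub>R w) d \<le> 0"
proof -
  have "\<forall>\<^sub>F \<epsilon> in at_right 0. inner (v + \<epsilon> *\<^sub>R w) d \<le> 0" if d: "d \<in> F" for d
  proof (cases "inner v d = 0")
    case True
    then show ?thesis
      using assms(3)[OF d] eventually_at_right_less[of "0::real"]
      by (auto simp: inner_add_left mult_nonneg_nonpos elim!: eventually_mono)
  next
    case False
    then have "inner v d < 0" using assms(2)[OF d] by simp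
    moreover have "((\<lambda>\<epsilon>. inner v d + \<epsilon> * inner w d) \<longlongrightarrow> inner v d + 0 * inner w d) (at_right 0)"
      by (intro tendsto_intros)
    ultimately have "\<forall>\<^sub>F \<epsilon> in at_right 0. inner v d + \<epsilon> * inner w d < 0"
      by (auto dest: order_tendstoD(2))
    then show ?thesis by (auto simp: inner_add_left elim!: eventually_mono)
  qed
  then have "\<forall>\<^sub>F \<epsilon> in at_right 0. \<forall>d\<in>F. inner (v + \<epsilon> *\<^sub>R w) d \<le> 0"
    by (simp add: eventually_ball_finite assms(1))
  then have "\<forall>\<^sub>F \<epsilon>::real in at_right 0. \<epsilon> > 0 \<and> (\<forall>d\<in>F. inner (v + \<epsilon> *\<^sub>R w) d \<le> 0)"
    using eventually_at_right_less[of "0::real"] by (rule eventually_conj[rotated])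
  then show ?thesis using eventually_happens' trivial_limit_at_right_real by blast
qed

theorem theorem3p1p3:
  fixes K :: "'k ring"
    and A :: "('k, 'a) module"
    and P :: "'n::finite \<Rightarrow> ('a, 'p) module"
    and M :: "('a, 'm) module"
    and v :: "real ^ 'n"
  assumes "fin_dim_algebra K A"
    and "card (simple_classes A) = CARD('n)"
    and "indec_projectives A P"
    and "v \<noteq> 0"
    and "fg_left_module A M"
    and "nonzero_module M"
    and "v \<in> stab_domain K A P M"
  shows "stab_domain_local K A P v M = stab_domain_perp K A P v M"
proof
  interpret finite_dimensional_algebra K A by unfold_locales (rule assms(1))
  let ?dim = "\<lambda>N. dim_vec K A P (restrict_to M N)"
  have v: "inner v (dim_vec K A P M) = 0"
    and v_sub: "\<And>N. Module.submodule N A M \<Longrightarrow> inner v (?dim N) \<le> 0"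
    using assms(7) unfolding stab_domain_def by auto
  show "stab_domain_local K A P v M \<subseteq> stab_domain_perp K A P v M"
    using v unfolding stab_domain_local_def stab_domain_perp_def stab_domain_def
    by (auto simp: inner_add_left mult_le_0_iff)
  show "stab_domain_perp K A P v M \<subseteq> stab_domain_local K A P v M"
  proof
    fix w assume w: "w \<in> stab_domain_perp K A P v M"
    have "finite {?dim N | N. Module.submodule N A M}"
      by (rule finite_submodule_dim_vecs)
        (use assms(3,5) in \<open>auto simp: indec_projectives_def indec_projective_def\<close>)
    then obtain \<epsilon> where "\<epsilon> > 0"
      and "\<forall>d \<in> {?dim N | N. Module.submodule N A M}. inner (v + \<epsilon> *\<^sub>R w) d \<le> 0"
      using finite_small_perturbation_nonpos[of "{?dim N | N. Module.submodule N A M}" v w]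
        v_sub w unfolding stab_domain_perp_def by auto
    then have "v + \<epsilon> *\<^sub>R w \<in> stab_domain K A P M"
      using v w unfolding stab_domain_def stab_domain_perp_def by (auto simp: inner_add_left)
    then show "w \<in> stab_domain_local K A P v M"
      using w \<open>\<epsilon> > 0\<close> unfolding stab_domain_local_def stab_domain_perp_def by auto
  qed
qed

end
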